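(* Let $(X,X_+,\mathcal{K},f)$ be an abstract state space and let $\{P_n\}_{n\ge1}$ be a left decreasing sequence of Markov projections of $X$ which converges to $P$ in norm. Let $\{T_n\}_{n\ge1}$ and $\{S_n\}_{n\ge1}$ be sequences of Markov operators on $X$, the generating sequences of the NDMCs $\{T^{k,n}\}$ and $\{S^{k,n}\}$, respectively. Assume that for all $n\in\mathbb{N}$ one has $T_nP_n=P_nT_n$, $S_nP_n=P_nS_n$, $T_nP_n=P_n$, $S_nP_n=P_n$, and that $\sum_{n=1}^\infty\|T_n-S_n\|<\infty$. Then the following statements hold: (i) $\{T^{m,n}\}$ is uniformly $P$-ergodic if and only if $\{S^{m,n}\}$ is uniformly $P$-ergodic; (ii) $\{T^{m,n}\}$ is weakly $P$-ergodic if and only if $\{S^{m,n}\}$ is weakly $P$-ergodic.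
   Context: Abstract state space: $X$ is a real ordered vector space with generating cone $X_+=\{x\in X: x\ge 0\}$ (i.e. $X=X_+-X_+$), $f$ is a strictly positive linear functional on $X$ ($f(x)>0$ for $x>0$), and $\mathcal{K}=\{x\in X_+: f(x)=1\}$. With $U$ the convex hull of $\mathcal{K}\cup(-\mathcal{K})$, put $\|x\|=\inf\{\lambda\in\mathbb{R}_+: x\in\lambda U\}$. $(X,X_+,\mathcal{K},f)$ is an abstract state space if $\|\cdot\|$ is a norm, $X$ is complete for it, and $X_+$ is closed. $X$ always carries this norm, and norms of operators are the induced operator norms. Markov operator: a linear $T:X\to X$ that is positive and satisfies $T(\mathcal{K})\subset\mathcal{K}$ (then $\|T\|=1$). Markov projection: a Markov operator $P$ with $P^2=P$. $\mathbb{N}=\{1,2,\dots\}$. The nonhomogeneous discrete Markov chain (NDMC) generated by $\{T_n\}_{n\ge1}$ is the family $T^{k,n}=T_nT_{n-1}\cdots T_{k+1}$, $0\le k<n$; similarly $S^{k,n}=S_nS_{n-1}\cdots S_{k+1}$. A sequence of projections $\{P_n\}$ is left decreasing if $P_{n+1}P_n=P_{n+1}$ for all $n\in\mathbb{N}$. Generalized Dobrushin coefficient: for a projection $P\neq I$, $N_P=\{x\in X: Px=0\}$ and $\delta_P(T)=\sup_{x\in N_P,\,x\ne0}\|Tx\|/\|x\|$ for bounded linear $T$; by convention $\delta_I(T)=1$. An NDMC $\{T^{k,n}\}$ is uniformly $P$-ergodic if $\lim_{n\to\infty}\|T^{m,n}-P\|=0$ for every $m\ge0$, and weakly $P$-ergodic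 if $\lim_{n\to\infty}\delta_P(T^{m,n})=0$ for every $m\ge0$. *)

theory Defs
  imports "HOL-Analysis.Analysis"
begin

definition state_base :: "('a::ordered_real_vector \<Rightarrow> real) \<Rightarrow> 'a set" where
  "state_base f = {x. 0 \<le> x \<and> f x = 1}"

definition base_norm :: "('a::ordered_real_vector \<Rightarrow> real) \<Rightarrow> 'a \<Rightarrow> real" where
  "base_norm f x =
     Inf {l. 0 \<le> l \<and> x \<in> (\<lambda>u. l *\<^sub>R u) ` (convex hull (state_base f \<union> uminus ` state_base f))}"

text \<open>
  The positive cone is that of the order of the type.  The norm of the type is required to be
  the gauge of the convex hull of the base and its negative; so that this gauge is a complete
  norm is expressed by the class \<^class>\<open>banach\<close>, and topological notions and operator norms are
  those of the library.
\<close>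

locale abstract_state_space =
  fixes f :: "'a::{ordered_real_vector, banach} \<Rightarrow> real"
  assumes generating: "\<exists>y z. 0 \<le> y \<and> 0 \<le> z \<and> x = y - z"
    and linear_functional: "linear f"
    and strictly_positive: "0 < x \<Longrightarrow> 0 < f x"
    and norm_eq_base_norm: "norm x = base_norm f x"
    and closed_cone: "closed {x::'a. 0 \<le> x}"

definition markov_operator ::
    "('a::ordered_real_vector \<Rightarrow> real) \<Rightarrow> ('a \<Rightarrow> 'a) \<Rightarrow> bool" where
  "markov_operator f T \<longleftrightarrow>
     linear T \<and> (\<forall>x\<ge>0. 0 \<le> T x) \<and> T ` state_base f \<subseteq> state_base f"

definition markov_projection ::
    "('a::ordered_real_vector \<Rightarrow> real) \<Rightarrow> ('a \<Rightarrow> 'a) \<Rightarrow> bool" where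
  "markov_projection f P \<longleftrightarrow> markov_operator f P \<and> P \<circ> P = P"

text \<open>
  Sequences of operators are indexed by the positive integers; their value at \<open>0\<close> is never used.
\<close>

definition left_decreasing :: "(nat \<Rightarrow> 'a \<Rightarrow> 'a) \<Rightarrow> bool" where
  "left_decreasing P \<longleftrightarrow> (\<forall>n\<ge>1. P (Suc n) \<circ> P n = P (Suc n))"

text \<open>
  \<open>ndmc T k n\<close> is \<open>T n \<circ> \<dots> \<circ> T (k + 1)\<close> for \<open>k < n\<close>, and the identity (empty product) for \<open>n \<le> k\<close>.
\<close>

primrec ndmc :: "(nat \<Rightarrow> 'a \<Rightarrow> 'a) \<Rightarrow> nat \<Rightarrow> nat \<Rightarrow> 'a \<Rightarrow> 'a" where
  "ndmc T k 0 = id"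
| "ndmc T k (Suc n) = (if k \<le> n then T (Suc n) \<circ> ndmc T k n else id)"

text \<open>
  For a projection \<open>P \<noteq> id\<close> and bounded linear \<open>T\<close> the supremum is over a nonempty bounded set.
\<close>

definition dobrushin ::
    "('a::real_normed_vector \<Rightarrow> 'a) \<Rightarrow> ('a \<Rightarrow> 'a) \<Rightarrow> real" where
  "dobrushin P T =
     (if P = id then 1 else Sup {norm (T x) / norm x |x. P x = 0 \<and> x \<noteq> 0})"

definition uniformly_ergodic ::
    "('a::real_normed_vector \<Rightarrow> 'a) \<Rightarrow> (nat \<Rightarrow> 'a \<Rightarrow> 'a) \<Rightarrow> bool" where
  "uniformly_ergodic P T \<longleftrightarrow> (\<forall>m. (\<lambda>n. onorm (\<lambda>x. ndmc T m n x - P x)) \<longlonglongrightarrow> 0)"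

definition weakly_ergodic ::
    "('a::real_normed_vector \<Rightarrow> 'a) \<Rightarrow> (nat \<Rightarrow> 'a \<Rightarrow> 'a) \<Rightarrow> bool" where
  "weakly_ergodic P T \<longleftrightarrow> (\<forall>m. (\<lambda>n. dobrushin P (ndmc T m n)) \<longlonglongrightarrow> 0)"

end

theory Submission
  imports Defs
begin

text \<open>
  The proof rests on two facts.

  First, every operator of the chains is absorbed by the limit projection from the left:
  \<open>P \<circ> T n = P = P \<circ> S n\<close>.  Left monotonicity gives \<open>Pn k \<circ> Pn n = Pn k\<close> for all \<open>k \<ge> n\<close>, hence
  \<open>P \<circ> Pn n = P\<close> in the limit, and \<open>Pn n \<circ> T n = T n \<circ> Pn n = Pn n\<close> then yields
  \<open>P \<circ> T n = P \<circ> Pn n \<circ> T n = P \<circ> Pn n = P\<close> (lemma \<open>limit_absorbs_operator\<close>).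

  Second, Markov operators are contractions of the base norm (lemma \<open>markov_operator_norm_le\<close>),
  so the two chains started at time \<open>k\<close> differ at every later time by at most the tail
  \<open>\<Sum>j\<ge>k. \<parallel>T (j+1) - S (j+1)\<parallel>\<close> (lemma \<open>ndmc_diff_le\<close>).

  Absorption allows the initial segment of the chain to be dropped: for \<open>m \<le> k \<le> n\<close>, writing
  \<open>S(m,n)\<close> for \<open>ndmc S m n\<close>, one has \<open>S(m,n) - P = (S(k,n) - P) \<circ> S(m,k)\<close>, whence
  \<open>\<parallel>S(m,n) - P\<parallel> \<le> \<parallel>S(k,n) - P\<parallel> \<le> \<parallel>T(k,n) - P\<parallel> + \<Sum>j\<ge>k. \<parallel>T (j+1) - S (j+1)\<parallel>\<close>.
  Choosing first \<open>k\<close> large makes the tail small, and then \<open>n\<close> large makes the other term small if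
  \<open>T\<close> is uniformly ergodic.  The factorization and the estimates hold equally after restriction to
  \<open>ker P\<close>, which the operators leave invariant because \<open>P\<close> absorbs them; there \<open>P\<close> vanishes and
  the operator norm is the Dobrushin coefficient.  So both equivalences are instances of one
  statement about an invariant set (lemma \<open>ergodic_on_transfer\<close>).
\<close>

section \<open>Markov operators are contractions\<close>

text \<open>
  The infimum defining the base norm has to range over a nonempty set, since \<open>Inf {}\<close> carries no
  information in the reals.  The vector \<open>0\<close> is excluded because the base of the zero space is
  empty.
\<close>

lemma (in abstract_state_space) gauge_set_nonempty:
  assumes "x \<noteq> 0"
  shows "\<exists>l\<ge>0. x \<in> (\<lambda>u. l *\<^sub>R u) ` (convex hull (state_base f \<union> uminus ` state_base f))"
    (is "\<exists>l\<ge>0. x \<in> (\<lambda>u. l *\<^sub>R u) ` ?U")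
proof -
  have normalize: "y /\<^sub>R f y \<in> state_base f" "0 < f y" if "0 \<le> y" "y \<noteq> 0" for y
  proof -
    show "0 < f y"
      using strictly_positive[of y] that by auto
    then show "y /\<^sub>R f y \<in> state_base f"
      using that by (auto simp: state_base_def linear_scale[OF linear_functional]
          intro!: scaleR_nonneg_nonneg)
  qed
  have pos: "y /\<^sub>R f y \<in> ?U" if "0 \<le> y" "y \<noteq> 0" for y
    using normalize(1)[OF that] by (intro hull_inc) auto
  have neg: "- (y /\<^sub>R f y) \<in> ?U" if "0 \<le> y" "y \<noteq> 0" for y
    using normalize(1)[OF that] by (intro hull_inc) auto
  obtain y z where yz: "0 \<le> y" "0 \<le> z" "x = y - z"
    using generating by blast
  consider "z = 0" "y \<noteq> 0" | "y = 0" "z \<noteq> 0" | "y \<noteq> 0" "z \<noteq> 0"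
    using yz assms by auto
  then show ?thesis
  proof cases
    case 1
    then show ?thesis
      using yz normalize[of y] pos[of y]
      by (intro exI[of _ "f y"]) (auto intro!: image_eqI[of _ _ "y /\<^sub>R f y"])
  next
    case 2
    then show ?thesis
      using yz normalize[of z] neg[of z]
      by (intro exI[of _ "f z"]) (auto intro!: image_eqI[of _ _ "- (z /\<^sub>R f z)"])
  next
    case 3
    have p: "0 < f y" "0 < f z"
      using 3 yz normalize by auto
    let ?s = "f y + f z"
    have "(f y / ?s) *\<^sub>R (y /\<^sub>R f y) + (f z / ?s) *\<^sub>R (- (z /\<^sub>R f z)) \<in> ?U"
      using 3 yz pos neg p
      by (intro convexD[OF convex_convex_hull]) (auto simp: add_divide_distrib[symmetric])
    also have "(f y / ?s) *\<^sub>R (y /\<^sub>R f y) + (f z / ?s) *\<^sub>R (- (z /\<^sub>R f z)) = x /\<^sub>R ?s"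
      using p yz by (simp add: scaleR_diff_right divide_simps)
    finally have "x \<in> (\<lambda>u. ?s *\<^sub>R u) ` ?U"
      using p by (intro image_eqI[of _ _ "x /\<^sub>R ?s"]) auto
    then show ?thesis
      using p by (intro exI[of _ ?s]) auto
  qed
qed

text \<open>
  A linear map of the base into itself maps the unit body, the convex hull of the base and its
  negative, into itself; so it does not increase the gauge of that body.
\<close>

lemma (in abstract_state_space) markov_operator_norm_le:
  assumes "markov_operator f T"
  shows "norm (T x) \<le> norm x"
proof (cases "x = 0")
  case True
  then show ?thesis
    using assms by (simp add: markov_operator_def linear_0)
next
  case False
  let ?B = "state_base f \<union> uminus ` state_base f"
  let ?L = "\<lambda>x. {l. 0 \<le> l \<and> x \<in> (\<lambda>u. l *\<^sub>R u) ` (convex hull ?B)}"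
  have lin: "linear T" and base: "T ` state_base f \<subseteq> state_base f"
    using assms by (auto simp: markov_operator_def)
  have "T ` ?B \<subseteq> ?B"
    using base linear_neg[OF lin] by fastforce
  then have "T ` (convex hull ?B) \<subseteq> convex hull ?B"
    by (metis convex_hull_linear_image[OF lin] hull_mono)
  then have "?L x \<subseteq> ?L (T x)"
    using linear_scale[OF lin] by fastforce
  moreover have "?L x \<noteq> {}"
    using gauge_set_nonempty[OF False] by auto
  moreover have "bdd_below (?L (T x))"
    by (auto intro: bdd_belowI[of _ 0])
  ultimately have "Inf (?L (T x)) \<le> Inf (?L x)"
    by (intro cInf_superset_mono) auto
  then show ?thesis
    by (simp add: norm_eq_base_norm base_norm_def)
qed

definition contraction :: "('a::real_normed_vector \<Rightarrow> 'a) \<Rightarrow> bool" where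
  "contraction A \<longleftrightarrow> linear A \<and> (\<forall>x. norm (A x) \<le> norm x)"

lemma contraction_norm_le: "contraction A \<Longrightarrow> norm (A x) \<le> norm x"
  by (simp add: contraction_def)

lemma contraction_bounded_linear: "contraction A \<Longrightarrow> bounded_linear A"
  unfolding contraction_def
  by (auto simp: bounded_linear_def bounded_linear_axioms_def intro!: exI[of _ 1])

lemma (in abstract_state_space) markov_operator_contraction:
  "markov_operator f T \<Longrightarrow> contraction T"
  using markov_operator_norm_le by (auto simp: contraction_def markov_operator_def)

section \<open>Comparison of products of contractions\<close>

lemma ndmc_contraction:
  assumes "\<And>n. n \<ge> 1 \<Longrightarrow> contraction (T n)"
  shows "contraction (ndmc T m n)"
proof (induction n)
  case 0
  show ?case
    by (simp add: contraction_def linear_iff)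
next
  case (Suc n)
  show ?case
    using Suc assms[of "Suc n"]
    by (auto simp: contraction_def linear_iff intro: order_trans)
qed

lemma ndmc_split:
  assumes "m \<le> k" "k \<le> n"
  shows "ndmc T m n x = ndmc T k n (ndmc T m k x)"
  using assms(2)
proof (induction n rule: dec_induct)
  case base
  have "ndmc T k k = id"
    by (cases k) auto
  then show ?case
    by simp
next
  case (step n)
  then show ?case
    using assms(1) by simp
qed

lemma ndmc_invariant:
  assumes "\<And>n x. n \<ge> 1 \<Longrightarrow> P (T n x) = P x"
  shows "P (ndmc T m n x) = P x"
  by (induction n) (use assms in auto)

text \<open>
  The two products are compared one factor at a time,
  \<open>T (Suc n) A - S (Suc n) B = T (Suc n) (A - B) + (T (Suc n) - S (Suc n)) B\<close>: the contraction
  \<open>T (Suc n)\<close> does not increase the previous error, and \<open>B\<close> has norm at most \<open>1\<close>.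
\<close>

lemma ndmc_diff_le:
  assumes T: "\<And>n. n \<ge> 1 \<Longrightarrow> contraction (T n)"
    and S: "\<And>n. n \<ge> 1 \<Longrightarrow> contraction (S n)"
    and "k \<le> n"
  shows "norm (ndmc T k n x - ndmc S k n x)
    \<le> (\<Sum>j=k..<n. onorm (\<lambda>x. T (Suc j) x - S (Suc j) x)) * norm x"
  using \<open>k \<le> n\<close>
proof (induction n rule: dec_induct)
  case base
  have "ndmc T k k = id" "ndmc S k k = id"
    by (cases k; simp)+
  then show ?case
    by simp
next
  case (step n)
  let ?A = "ndmc T k n x" and ?B = "ndmc S k n x"
  let ?d = "onorm (\<lambda>x. T (Suc n) x - S (Suc n) x)"
  have bl: "bounded_linear (T (Suc n))" "bounded_linear (S (Suc n))"
    using T S by (auto intro: contraction_bounded_linear)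
  have "norm (T (Suc n) ?A - S (Suc n) ?B)
      = norm (T (Suc n) (?A - ?B) + (T (Suc n) ?B - S (Suc n) ?B))"
    using bl by (simp add: bounded_linear.linear linear_diff)
  also have "\<dots> \<le> norm (T (Suc n) (?A - ?B)) + norm (T (Suc n) ?B - S (Suc n) ?B)"
    by (rule norm_triangle_ineq)
  also have "\<dots> \<le> norm (?A - ?B) + ?d * norm ?B"
    using T[of "Suc n"] onorm[OF bounded_linear_sub[OF bl], of ?B]
    by (intro add_mono) (auto intro: contraction_norm_le)
  also have "\<dots> \<le> norm (?A - ?B) + ?d * norm x"
    using contraction_norm_le[OF ndmc_contraction[OF S]] onorm_pos_le[OF bounded_linear_sub[OF bl]]
    by (intro add_mono mult_left_mono) auto
  finally show ?case
    using step by (simp add: algebra_simps)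
qed

section \<open>Ergodicity on an invariant set\<close>

text \<open>
  Operator norm convergence of the restrictions to \<open>V\<close>, written as an estimate on vectors in order
  to cover \<open>V = UNIV\<close> and \<open>V = ker P\<close> at once.
\<close>

definition ergodic_on ::
    "'a set \<Rightarrow> ('a::real_normed_vector \<Rightarrow> 'a) \<Rightarrow> (nat \<Rightarrow> 'a \<Rightarrow> 'a) \<Rightarrow> bool" where
  "ergodic_on V P T \<longleftrightarrow> (\<forall>m. \<forall>e>0. \<forall>\<^sub>F n in sequentially.
     \<forall>x\<in>V. norm (ndmc T m n x - P x) \<le> e * norm x)"

text \<open>
  The factorization \<open>ndmc S m n - P = (ndmc S k n - P) \<circ> ndmc S m k\<close> allows the comparison with \<open>T\<close>
  to begin at a time \<open>k\<close> after which the two chains stay close.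
\<close>

lemma ergodic_on_transfer:
  assumes T: "\<And>n. n \<ge> 1 \<Longrightarrow> contraction (T n)"
    and S: "\<And>n. n \<ge> 1 \<Longrightarrow> contraction (S n)"
    and absorb: "\<And>n x. n \<ge> 1 \<Longrightarrow> P (S n x) = P x"
    and invariant: "\<And>n x. n \<ge> 1 \<Longrightarrow> x \<in> V \<Longrightarrow> S n x \<in> V"
    and summable: "summable (\<lambda>n. onorm (\<lambda>x. T (Suc n) x - S (Suc n) x))"
    and ergodic: "ergodic_on V P T"
  shows "ergodic_on V P S"
  unfolding ergodic_on_def
proof (intro allI impI)
  fix m :: nat and e :: real
  assume "0 < e"
  let ?d = "\<lambda>n. onorm (\<lambda>x. T (Suc n) x - S (Suc n) x)"
  obtain N where N: "\<And>k n. k \<ge> N \<Longrightarrow> norm (sum ?d {k..<n}) < e / 2"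
    using summable \<open>0 < e\<close> unfolding summable_Cauchy by (meson half_gt_zero)
  define k where "k = max m N"
  have k: "m \<le> k" "N \<le> k"
    by (auto simp: k_def)
  have "\<forall>\<^sub>F n in sequentially. \<forall>x\<in>V. norm (ndmc T k n x - P x) \<le> e / 2 * norm x"
    using ergodic \<open>0 < e\<close> unfolding ergodic_on_def by (meson half_gt_zero)
  then show "\<forall>\<^sub>F n in sequentially. \<forall>x\<in>V. norm (ndmc S m n x - P x) \<le> e * norm x"
    using eventually_ge_at_top[of k]
  proof eventually_elim
    case (elim n)
    \<comment> \<open>\<open>y\<close> is the state at time \<open>k\<close>; it has the same image under \<open>P\<close> as the initial state.\<close>
    show ?case
    proof
      fix x
      assume "x \<in> V"
      define y where "y = ndmc S m k x"
      have "y \<in> V"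
        unfolding y_def by (induction k) (use \<open>x \<in> V\<close> invariant in auto)
      have "P y = P x"
        unfolding y_def using absorb by (rule ndmc_invariant)
      then have "norm (ndmc S m n x - P x) = norm (ndmc S k n y - P y)"
        using ndmc_split[of m k n S x] k elim by (simp add: y_def)
      also have "\<dots> \<le> norm (ndmc T k n y - P y) + norm (ndmc T k n y - ndmc S k n y)"
        using norm_triangle_ineq4[of "ndmc T k n y - P y" "ndmc T k n y - ndmc S k n y"]
        by simp
      also have "\<dots> \<le> e / 2 * norm y + e / 2 * norm y"
      proof (rule add_mono)
        show "norm (ndmc T k n y - P y) \<le> e / 2 * norm y"
          using elim \<open>y \<in> V\<close> by blast
        have "norm (ndmc T k n y - ndmc S k n y) \<le> sum ?d {k..<n} * norm y"
          using T S elim(2) by (rule ndmc_diff_le)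
        also have "\<dots> \<le> e / 2 * norm y"
          using N[OF k(2), of n] by (intro mult_right_mono) auto
        finally show "norm (ndmc T k n y - ndmc S k n y) \<le> e / 2 * norm y" .
      qed
      also have "\<dots> \<le> e * norm x"
        using contraction_norm_le[OF ndmc_contraction[OF S]] \<open>0 < e\<close> by (simp add: y_def)
      finally show "norm (ndmc S m n x - P x) \<le> e * norm x" .
    qed
  qed
qed

lemma ergodic_on_cong:
  assumes T: "\<And>n. n \<ge> 1 \<Longrightarrow> contraction (T n)"
    and S: "\<And>n. n \<ge> 1 \<Longrightarrow> contraction (S n)"
    and "\<And>n x. n \<ge> 1 \<Longrightarrow> P (T n x) = P x"
    and "\<And>n x. n \<ge> 1 \<Longrightarrow> P (S n x) = P x"
    and "\<And>n x. n \<ge> 1 \<Longrightarrow> x \<in> V \<Longrightarrow> T n x \<in> V"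
    and "\<And>n x. n \<ge> 1 \<Longrightarrow> x \<in> V \<Longrightarrow> S n x \<in> V"
    and summable: "summable (\<lambda>n. onorm (\<lambda>x. T (Suc n) x - S (Suc n) x))"
  shows "ergodic_on V P T \<longleftrightarrow> ergodic_on V P S"
proof -
  have "onorm (\<lambda>x. S (Suc n) x - T (Suc n) x) = onorm (\<lambda>x. T (Suc n) x - S (Suc n) x)" for n
    using onorm_neg[of "\<lambda>x. T (Suc n) x - S (Suc n) x"] by simp
  then have "summable (\<lambda>n. onorm (\<lambda>x. S (Suc n) x - T (Suc n) x))"
    using summable by simp
  then show ?thesis
    using ergodic_on_transfer[of T S P V] ergodic_on_transfer[of S T P V] assms by blast
qed

section \<open>Uniform and weak ergodicity in terms of estimates on vectors\<close>

lemma nonneg_tendsto_zero_iff: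
  fixes g :: "nat \<Rightarrow> real"
  assumes "\<And>n. 0 \<le> g n"
  shows "g \<longlonglongrightarrow> 0 \<longleftrightarrow> (\<forall>e>0. \<forall>\<^sub>F n in sequentially. g n \<le> e)"
proof
  assume "g \<longlonglongrightarrow> 0"
  then show "\<forall>e>0. \<forall>\<^sub>F n in sequentially. g n \<le> e"
    by (auto dest: order_tendstoD(2) elim!: eventually_mono)
next
  assume *: "\<forall>e>0. \<forall>\<^sub>F n in sequentially. g n \<le> e"
  show "g \<longlonglongrightarrow> 0"
  proof (rule order_tendstoI)
    fix e :: real
    assume "0 < e"
    then have "\<forall>\<^sub>F n in sequentially. g n \<le> e / 2"
      using * half_gt_zero by blast
    then show "\<forall>\<^sub>F n in sequentially. g n < e"
      using \<open>0 < e\<close> by (auto elim!: eventually_mono)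
  next
    fix e :: real
    assume "e < 0"
    then show "\<forall>\<^sub>F n in sequentially. e < g n"
      using assms by (intro always_eventually allI) (rule less_le_trans)
  qed
qed

lemma onorm_le_iff:
  assumes "bounded_linear A" "0 \<le> e"
  shows "onorm A \<le> e \<longleftrightarrow> (\<forall>x. norm (A x) \<le> e * norm x)"
  using onorm[OF assms(1)] onorm_bound[OF assms(2)]
  by (meson mult_right_mono norm_ge_zero order_trans)

lemma uniformly_ergodic_iff:
  assumes "\<And>n. n \<ge> 1 \<Longrightarrow> contraction (T n)" "bounded_linear P"
  shows "uniformly_ergodic P T \<longleftrightarrow> ergodic_on UNIV P T"
proof -
  have bl: "bounded_linear (\<lambda>x. ndmc T m n x - P x)" for m n
    by (intro bounded_linear_sub contraction_bounded_linear ndmc_contraction assms)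
  show ?thesis
    unfolding uniformly_ergodic_def ergodic_on_def
    by (simp add: nonneg_tendsto_zero_iff onorm_pos_le[OF bl] onorm_le_iff[OF bl])
qed

text \<open>
  For a projection \<open>P \<noteq> id\<close> the vectors \<open>x - P x\<close> show that the supremum ranges over a nonempty
  set; for a contraction it is bounded by \<open>1\<close>.
\<close>

lemma
  assumes P: "linear P" "P \<circ> P = P" "P \<noteq> id" and A: "contraction A"
  shows dobrushin_nonneg: "0 \<le> dobrushin P A"
    and dobrushin_le_iff: "dobrushin P A \<le> e \<longleftrightarrow> (\<forall>x\<in>{x. P x = 0}. norm (A x) \<le> e * norm x)"
proof -
  let ?Q = "{norm (A x) / norm x |x. P x = 0 \<and> x \<noteq> 0}"
  have eq: "dobrushin P A = Sup ?Q"
    using P by (simp add: dobrushin_def)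
  obtain z where "P z \<noteq> z"
    using P(3) by (auto simp: fun_eq_iff)
  then have "P (z - P z) = 0" "z - P z \<noteq> 0"
    using P(2) by (auto simp: linear_diff[OF P(1)] fun_eq_iff)
  then have mem: "norm (A (z - P z)) / norm (z - P z) \<in> ?Q"
    by blast
  have bdd: "bdd_above ?Q"
    using contraction_norm_le[OF A] by (intro bdd_aboveI[of _ 1]) (auto simp: divide_le_eq)
  show "0 \<le> dobrushin P A"
    unfolding eq using cSup_upper[OF mem bdd] by (rule order_trans[rotated]) simp
  have "dobrushin P A \<le> e \<longleftrightarrow> (\<forall>q\<in>?Q. q \<le> e)"
    unfolding eq using mem bdd by (subst cSup_le_iff) auto
  also have "\<dots> \<longleftrightarrow> (\<forall>x. P x = 0 \<and> x \<noteq> 0 \<longrightarrow> norm (A x) \<le> e * norm x)"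
    by (auto simp: divide_le_eq)
  also have "\<dots> \<longleftrightarrow> (\<forall>x\<in>{x. P x = 0}. norm (A x) \<le> e * norm x)"
    using A linear_0 unfolding contraction_def by fastforce
  finally show "dobrushin P A \<le> e \<longleftrightarrow> (\<forall>x\<in>{x. P x = 0}. norm (A x) \<le> e * norm x)" .
qed

lemma weakly_ergodic_iff:
  assumes T: "\<And>n. n \<ge> 1 \<Longrightarrow> contraction (T n)" and P: "linear P" "P \<circ> P = P" "P \<noteq> id"
  shows "weakly_ergodic P T \<longleftrightarrow> ergodic_on {x. P x = 0} P T"
proof -
  have contr: "contraction (ndmc T m n)" for m n
    using T by (rule ndmc_contraction)
  show ?thesis
    unfolding weakly_ergodic_def ergodic_on_def
    by (simp add: nonneg_tendsto_zero_iff dobrushin_nonneg[OF P contr] dobrushin_le_iff[OF P contr])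
qed

text \<open>By convention the Dobrushin coefficient for the identity is constantly \<open>1\<close>.\<close>

lemma not_weakly_ergodic_id: "\<not> weakly_ergodic id T"
  by (simp add: weakly_ergodic_def dobrushin_def LIMSEQ_const_iff)

section \<open>The limit of a left decreasing sequence of projections\<close>

lemma left_decreasing_absorbs:
  assumes "left_decreasing Q" "Q n \<circ> Q n = Q n" "1 \<le> n" "n \<le> k"
  shows "Q k (Q n x) = Q k x"
  using \<open>n \<le> k\<close>
proof (induction k rule: dec_induct)
  case base
  then show ?case
    using assms(2) by (simp add: fun_eq_iff)
next
  case (step k)
  have "Q (Suc k) (Q k y) = Q (Suc k) y" for y
    using assms(1,3) step(1) unfolding left_decreasing_def by (metis comp_apply order_trans)
  then show ?case
    using step.IH by metis
qed

lemma onorm_tendsto_pointwise: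
  assumes "\<And>n. n \<ge> 1 \<Longrightarrow> bounded_linear (Q n)" "bounded_linear P"
    and lim: "(\<lambda>n. onorm (\<lambda>x. Q n x - P x)) \<longlonglongrightarrow> 0"
  shows "(\<lambda>n. Q n x) \<longlonglongrightarrow> P x"
proof -
  have "\<forall>\<^sub>F n in sequentially. norm (Q n x - P x) \<le> onorm (\<lambda>x. Q n x - P x) * norm x"
    using eventually_ge_at_top[of 1]
  proof eventually_elim
    case (elim n)
    show ?case
      by (rule onorm[OF bounded_linear_sub[OF assms(1)[OF elim] assms(2)]])
  qed
  moreover have "(\<lambda>n. onorm (\<lambda>x. Q n x - P x) * norm x) \<longlonglongrightarrow> 0"
    using tendsto_mult_left_zero[OF lim] .
  ultimately have "(\<lambda>n. Q n x - P x) \<longlonglongrightarrow> 0"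
    by (rule Lim_null_comparison)
  then show ?thesis
    by (simp add: LIM_zero_iff)
qed

text \<open>Pass to the limit \<open>k \<rightarrow> \<infinity>\<close> in \<open>Q k (Q n x) = Q k x\<close>.\<close>

lemma limit_absorbs_projection:
  fixes Q :: "nat \<Rightarrow> 'a::t2_space \<Rightarrow> 'a"
  assumes "left_decreasing Q" "Q n \<circ> Q n = Q n" "1 \<le> n"
    and lim: "\<And>x. (\<lambda>n. Q n x) \<longlonglongrightarrow> P x"
  shows "P (Q n x) = P x"
proof -
  have "\<forall>\<^sub>F k in sequentially. Q k (Q n x) = Q k x"
    using eventually_ge_at_top[of n]
    by eventually_elim (rule left_decreasing_absorbs[OF assms(1-3)])
  then have "(\<lambda>k. Q k x) \<longlonglongrightarrow> P (Q n x)"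
    by (rule Lim_transform_eventually[OF lim])
  then show ?thesis
    using lim[of x] by (rule LIMSEQ_unique)
qed

lemma limit_absorbs_operator:
  assumes absorb: "\<And>x. P (Q x) = P x" and "A \<circ> Q = Q \<circ> A" "A \<circ> Q = Q"
  shows "P (A x) = P x"
proof -
  have "Q (A x) = Q x"
    using assms(2,3) by (metis comp_apply)
  then show ?thesis
    using absorb by metis
qed

section \<open>Equivalence of the ergodicity of the two chains\<close>

theorem theorem6p6:
  fixes f :: "'a::{ordered_real_vector, banach} \<Rightarrow> real"
    and Pn T S :: "nat \<Rightarrow> 'a \<Rightarrow> 'a"
    and P :: "'a \<Rightarrow> 'a"
  assumes "abstract_state_space f"
    and "\<And>n. n \<ge> 1 \<Longrightarrow> markov_projection f (Pn n)"
    and "left_decreasing Pn"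
    and "bounded_linear P"
    and "(\<lambda>n. onorm (\<lambda>x. Pn n x - P x)) \<longlonglongrightarrow> 0"
    and "\<And>n. n \<ge> 1 \<Longrightarrow> markov_operator f (T n)"
    and "\<And>n. n \<ge> 1 \<Longrightarrow> markov_operator f (S n)"
    and "\<And>n. n \<ge> 1 \<Longrightarrow> T n \<circ> Pn n = Pn n \<circ> T n"
    and "\<And>n. n \<ge> 1 \<Longrightarrow> S n \<circ> Pn n = Pn n \<circ> S n"
    and "\<And>n. n \<ge> 1 \<Longrightarrow> T n \<circ> Pn n = Pn n"
    and "\<And>n. n \<ge> 1 \<Longrightarrow> S n \<circ> Pn n = Pn n"
    and "summable (\<lambda>n. onorm (\<lambda>x. T (Suc n) x - S (Suc n) x))"
  shows "(uniformly_ergodic P T \<longleftrightarrow> uniformly_ergodic P S) \<and>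
         (weakly_ergodic P T \<longleftrightarrow> weakly_ergodic P S)"
proof -
  note state_space = assms(1) and projection = assms(2) and decreasing = assms(3)
    and P = assms(4) and summable = assms(12)
  have T: "contraction (T n)" and S: "contraction (S n)" if "n \<ge> 1" for n
    using abstract_state_space.markov_operator_contraction[OF state_space] assms(6,7) that by auto
  have idem: "Pn n \<circ> Pn n = Pn n" and contr: "contraction (Pn n)" if "n \<ge> 1" for n
    using projection[OF that] abstract_state_space.markov_operator_contraction[OF state_space]
    by (auto simp: markov_projection_def)
  have lim: "(\<lambda>n. Pn n x) \<longlonglongrightarrow> P x" for x
    using onorm_tendsto_pointwise[OF _ P assms(5)] contr contraction_bounded_linear by blast
  have absorb: "P (Pn n x) = P x" if "n \<ge> 1" for n x
    using limit_absorbs_projection[OF decreasing idem[OF that] that lim] .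
  have PT: "P (T n x) = P x" and PS: "P (S n x) = P x" if "n \<ge> 1" for n x
    using absorb[OF that] assms(8-11)[OF that] by (auto intro: limit_absorbs_operator[of P "Pn n"])
  have "P (P x) = P x" for x
  proof -
    have "(\<lambda>n. P (Pn n x)) \<longlonglongrightarrow> P (P x)"
      using bounded_linear.tendsto[OF P lim] .
    moreover have "(\<lambda>n. P (Pn n x)) \<longlonglongrightarrow> P x"
      using absorb by (intro tendsto_eventually eventually_sequentiallyI[of 1])
    ultimately show ?thesis
      by (rule LIMSEQ_unique)
  qed
  then have idemP: "P \<circ> P = P"
    by auto
  have uniform: "uniformly_ergodic P T \<longleftrightarrow> uniformly_ergodic P S"
  proof -
    have "ergodic_on UNIV P T \<longleftrightarrow> ergodic_on UNIV P S"
      by (rule ergodic_on_cong[OF T S PT PS _ _ summable]) simp_all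
    moreover have "uniformly_ergodic P T \<longleftrightarrow> ergodic_on UNIV P T"
      using T P by (rule uniformly_ergodic_iff)
    moreover have "uniformly_ergodic P S \<longleftrightarrow> ergodic_on UNIV P S"
      using S P by (rule uniformly_ergodic_iff)
    ultimately show ?thesis
      by blast
  qed
  have weak: "weakly_ergodic P T \<longleftrightarrow> weakly_ergodic P S"
  proof (cases "P = id")
    case True
    then show ?thesis
      using not_weakly_ergodic_id by blast
  next
    case False
    have lin: "linear P"
      using P by (rule bounded_linear.linear)
    have "ergodic_on {x. P x = 0} P T \<longleftrightarrow> ergodic_on {x. P x = 0} P S"
      by (rule ergodic_on_cong[OF T S PT PS _ _ summable]) (simp_all add: PT PS)
    moreover have "weakly_ergodic P T \<longleftrightarrow> ergodic_on {x. P x = 0} P T"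
      using T lin idemP False by (rule weakly_ergodic_iff)
    moreover have "weakly_ergodic P S \<longleftrightarrow> ergodic_on {x. P x = 0} P S"
      using S lin idemP False by (rule weakly_ergodic_iff)
    ultimately show ?thesis
      by blast
  qed
  show ?thesis
    using uniform weak ..
qed

end
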